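(* Let $f\in C([0,1]^5)$ be a function $f(t,z_1,z_2,x,y)$ such that, in the domain $0\le t\le1$, $0\le z_1,z_2$, $z_1+z_2\le1$, $0\le x,y\le1$, $x+y\le1$, the quantities $D^{n+1}f$ exist (and are finite) for all $n=1,2,\dots$, and such that the series $$\frac{D^{m+1}f}{m+1}+\frac{2\,D^{m+2}f}{(m+1)(m+2)}+\frac{2^2\,D^{m+3}f}{(m+1)(m+2)(m+3)}+\cdots$$ converges for every integer $m\ge1$ and its sum is bounded above by a number $M$ that does not depend on $m$. Then for every integer $m\ge1$, every $t\in[0,1]$ and every $(x,y)\in\Phi$, $$\left|R_m^{\left[-\frac1m\right]}(F,x(\cdot),y(\cdot))\right|\le\frac{2^{2m+1}}{m!}\,M\le\frac{\sqrt2}{\sqrt{\pi m}}\left(\frac{4e}{m}\right)^m M.$$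
   Context: Let $\Delta_2=\{(z_1,z_2): z_1\ge0,\ z_2\ge0,\ z_1+z_2\le1\}$, and let $\Phi$ be the set of pairs $(x,y)$ with $x,y\in C[0,1]$, $x(z_1)\ge0$, $y(z_2)\ge0$ and $x(z_1)+y(z_2)\le1$ for all $(z_1,z_2)\in\Delta_2$. The Urison operator with kernel $f$ is $$F(t,x(\cdot),y(\cdot))=\iint_{\Delta_2} f(t,z_1,z_2,x(z_1),y(z_2))\,dz_1\,dz_2 .$$ For $m\ge1$ and $\alpha=-\frac1m$, the operator polynomial is $$P_m^{\left[\alpha\right]}(F,x(\cdot),y(\cdot))=\iint_{\Delta_2}\sum_{i,j\ge 0,\ i+j\le m} \frac{m!}{i!\,j!\,(m-i-j)!}\, v_m^{(i,j)}(x(z_1),y(z_2),\alpha)\, f\left(t,z_1,z_2,\frac im,\frac jm\right)dz_1\,dz_2,$$ where $$v_m^{(i,j)}(x,y,\alpha)=\frac{\prod_{k_1=0}^{i-1}(x+k_1\alpha)\,\prod_{k_2=0}^{j-1}(y+k_2\alpha)\,\prod_{k_3=0}^{m-i-j-1}(1-x-y+k_3\alpha)}{\prod_{k_4=0}^{m-1}(1+k_4\alpha)},$$ and empty products equal $1$. The error is $$R_m^{\left[-\frac1m\right]}(F,x(\cdot),y(\cdot))=F(t,x(\cdot),y(\cdot))-P_m^{\left[-\frac1m\right]}(F,x(\cdot),y(\cdot)).$$ For $n\ge 1$, $$D^{n+1}f=\max_{0\le k\le n+1}\ \max_{\substack{0\le t,z_1,z_2\le1\\ z_1+z_2\le1}}\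 \max_{\substack{0\le x,y\le1\\ x+y\le1}}\left|\frac{\partial^{n+1}}{\partial x^k\,\partial y^{n+1-k}}f(t,z_1,z_2,x,y)\right|.$$ *)

theory Defs
  imports "HOL-Analysis.Analysis"
begin

definition Delta2 :: "(real \<times> real) set" where
  "Delta2 = {(z1, z2). 0 \<le> z1 \<and> 0 \<le> z2 \<and> z1 + z2 \<le> 1}"

definition Phi :: "((real \<Rightarrow> real) \<times> (real \<Rightarrow> real)) set" where
  "Phi = {(x, y). continuous_on {0..1} x \<and> continuous_on {0..1} y \<and>
     (\<forall>(z1, z2)\<in>Delta2. 0 \<le> x z1 \<and> 0 \<le> y z2 \<and> x z1 + y z2 \<le> 1)}"

type_synonym kernel = "real \<Rightarrow> real \<Rightarrow> real \<Rightarrow> real \<Rightarrow> real \<Rightarrow> real"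

definition Urison :: "kernel \<Rightarrow> real \<Rightarrow> (real \<Rightarrow> real) \<Rightarrow> (real \<Rightarrow> real) \<Rightarrow> real" where
  "Urison f t x y =
     set_lebesgue_integral lborel Delta2 (\<lambda>(z1, z2). f t z1 z2 (x z1) (y z2))"

definition v_basis :: "nat \<Rightarrow> nat \<Rightarrow> nat \<Rightarrow> real \<Rightarrow> real \<Rightarrow> real \<Rightarrow> real" where
  "v_basis m i j x y \<alpha> =
     ((\<Prod>k<i. x + real k * \<alpha>) * (\<Prod>k<j. y + real k * \<alpha>) *
      (\<Prod>k<m - i - j. 1 - x - y + real k * \<alpha>)) /
     (\<Prod>k<m. 1 + real k * \<alpha>)"

definition P_op ::
  "nat \<Rightarrow> real \<Rightarrow> kernel \<Rightarrow> real \<Rightarrow> (real \<Rightarrow> real) \<Rightarrow> (real \<Rightarrow> real) \<Rightarrow> real" where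
  "P_op m \<alpha> f t x y =
     set_lebesgue_integral lborel Delta2 (\<lambda>(z1, z2).
       \<Sum>(i, j)\<in>{(i, j). i + j \<le> m}.
         fact m / (fact i * fact j * fact (m - i - j)) * v_basis m i j (x z1) (y z2) \<alpha> *
         f t z1 z2 (real i / real m) (real j / real m))"

definition R_op ::
  "nat \<Rightarrow> real \<Rightarrow> kernel \<Rightarrow> real \<Rightarrow> (real \<Rightarrow> real) \<Rightarrow> (real \<Rightarrow> real) \<Rightarrow> real" where
  "R_op m \<alpha> f t x y = Urison f t x y - P_op m \<alpha> f t x y"

text \<open>
  Partial derivatives on the closed triangle \<open>x, y \<ge> 0\<close>, \<open>x + y \<le> 1\<close> are taken relative to the
  triangle: along the section through the point, hence one-sided at its end points.
\<close>

definition partial_x :: "(real \<Rightarrow> real \<Rightarrow> real) \<Rightarrow> real \<Rightarrow> real \<Rightarrow> real" where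
  "partial_x g x y = vector_derivative (\<lambda>u. g u y) (at x within {0..1 - y})"

definition partial_y :: "(real \<Rightarrow> real \<Rightarrow> real) \<Rightarrow> real \<Rightarrow> real \<Rightarrow> real" where
  "partial_y g x y = vector_derivative (\<lambda>v. g x v) (at y within {0..1 - x})"

definition mixed_partial :: "nat \<Rightarrow> nat \<Rightarrow> (real \<Rightarrow> real \<Rightarrow> real) \<Rightarrow> real \<Rightarrow> real \<Rightarrow> real" where
  "mixed_partial k l g = (partial_x ^^ k) ((partial_y ^^ l) g)"

text \<open>
  The horizontal section through the corner \<open>(0, 1)\<close> and the vertical section through \<open>(1, 0)\<close>
  are single points, on which differentiation is meaningless (every number is a derivative there).
  Hence \<open>(0, 1)\<close> is left out when \<open>k > 0\<close>, and \<open>(1, 0)\<close> when \<open>l > 0\<close>. If the derivatives are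
  continuous up to the corners, this does not change the suprema below.
\<close>

definition xy_dom :: "nat \<Rightarrow> nat \<Rightarrow> (real \<times> real) set" where
  "xy_dom k l = {(x, y). 0 \<le> x \<and> x \<le> 1 \<and> 0 \<le> y \<and> y \<le> 1 \<and> x + y \<le> 1 \<and>
     (k > 0 \<longrightarrow> y < 1) \<and> (l > 0 \<longrightarrow> x < 1)}"

fun mixed_partial_exists :: "nat \<Rightarrow> nat \<Rightarrow> (real \<Rightarrow> real \<Rightarrow> real) \<Rightarrow> bool" where
  "mixed_partial_exists 0 0 g \<longleftrightarrow> True"
| "mixed_partial_exists 0 (Suc l) g \<longleftrightarrow> mixed_partial_exists 0 l g \<and>
     (\<forall>(x, y)\<in>xy_dom 0 (Suc l).
        (\<lambda>v. mixed_partial 0 l g x v) differentiable (at y within {0..1 - x}))"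
| "mixed_partial_exists (Suc k) l g \<longleftrightarrow> mixed_partial_exists k l g \<and>
     (\<forall>(x, y)\<in>xy_dom (Suc k) l.
        (\<lambda>u. mixed_partial k l g u y) differentiable (at x within {0..1 - y}))"

definition abs_partials :: "nat \<Rightarrow> kernel \<Rightarrow> real set" where
  "abs_partials N f =
     {\<bar>mixed_partial k (N - k) (f t z1 z2) x y\<bar> | k t z1 z2 x y.
        k \<le> N \<and> t \<in> {0..1} \<and> (z1, z2) \<in> Delta2 \<and> (x, y) \<in> xy_dom k (N - k)}"

definition D_max :: "nat \<Rightarrow> kernel \<Rightarrow> real" where
  "D_max N f = Sup (abs_partials N f)"

definition D_max_exists :: "nat \<Rightarrow> kernel \<Rightarrow> bool" where
  "D_max_exists N f \<longleftrightarrow>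
     (\<forall>t\<in>{0..1}. \<forall>(z1, z2)\<in>Delta2. \<forall>k\<le>N. mixed_partial_exists k (N - k) (f t z1 z2)) \<and>
     bdd_above (abs_partials N f)"

end

theory Submission
  imports Defs
begin

text \<open>
  For \<open>\<alpha> = - 1 / m\<close> every factor \<open>x + k * \<alpha>\<close> is \<open>(m * x - k) / m\<close>, so the coefficients of the
  operator polynomial are products of binomial coefficients: with \<open>a = m * x\<close>, \<open>b = m * y\<close> and
  \<open>c = m * (1 - x - y)\<close> the coefficient at the node \<open>(i / m, j / m)\<close> is
  \<open>(a gchoose i) * (b gchoose j) * (c gchoose (m - i - j))\<close>. These are the fundamental polynomials
  of Lagrange interpolation at the nodes \<open>(i / m, j / m)\<close>, \<open>i + j \<le> m\<close>. Hence, for fixed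
  \<open>t, z1, z2\<close>, the integrand of the error is the error of interpolating the function
  \<open>g = f t z1 z2\<close> on the unit triangle, and it suffices to bound that error pointwise: the domain
  of integration has area at most 1.

  Interpolation reproduces polynomials of degree at most \<open>m\<close> (\<open>interp_monomial\<close>), so its error is
  unchanged when the Taylor polynomial \<open>T\<close> of degree \<open>m\<close> at the origin is subtracted from \<open>g\<close>. Two
  estimates then suffice. First, the Lebesgue constant is at most
  \<open>(2 * m - 1) choose m \<le> 4 ^ m\<close> (\<open>sum_abs_weight_le\<close>), because
  \<open>\<bar>a gchoose i\<bar>\<close> is at most the rising analogue \<open>pochhammer a i / fact i\<close> and the rising analogues add
  up by Vandermonde's identity. Secondly, \<open>\<bar>g - T\<bar> \<le> D / fact (m + 1)\<close> on the triangle, where \<open>D\<close>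
  bounds the derivatives of order \<open>m + 1\<close> (\<open>Taylor_triangle\<close>); no power of 2 occurs, as
  \<open>x + y \<le> 1\<close>. Together the error is at most
  \<open>(1 + 4 ^ m) / fact m * (D / (m + 1)) \<le> 2 ^ (2 * m + 1) / fact m * M\<close>: the number \<open>D / (m + 1)\<close> is
  the first term of the series, whose terms are nonnegative.

  The second inequality of the theorem is the lower Stirling bound
  \<open>sqrt (2 * pi * m) * (m / exp 1) ^ m \<le> fact m\<close> (\<open>fact_ge_stirling\<close>).
\<close>

section \<open>Stirling's lower bound for the factorial\<close>

text \<open>
  The logarithm of \<open>fact n / (sqrt n * (n / exp 1) ^ n)\<close>. It decreases to its limit, so a lower bound
  for \<open>fact n\<close> follows from the value \<open>ln (sqrt (2 * pi))\<close> of the limit.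
\<close>

definition stirling_log :: "nat \<Rightarrow> real" where
  "stirling_log n = ln (fact n) - (real n + 1 / 2) * ln (real n) + real n"

lemma stirling_log_diff:
  assumes "n > 0"
  shows "stirling_log n - stirling_log (Suc n)
    = (real n + 1 / 2) * (ln (real n + 1) - ln (real n)) - 1"
proof -
  have "ln (fact (Suc n)) = ln (real n + 1) + ln (fact n :: real)"
    using ln_mult[of "real n + 1" "fact n"] by (simp add: add.commute)
  then show ?thesis
    by (simp add: stirling_log_def algebra_simps del: fact_Suc)
qed

lemma stirling_log_decreasing:
  assumes "n > 0"
  shows "stirling_log (Suc n) \<le> stirling_log n"
proof -
  have "2 / (2 * real n + 1) \<le> ln (real n + 1) - ln (real n)"
    using ln_inverse_approx_ge[of "real n" "real n + 1"] assms by (simp add: add_ac)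
  then have "1 \<le> (real n + 1 / 2) * (ln (real n + 1) - ln (real n))"
    by (simp add: field_simps)
  then show ?thesis using stirling_log_diff[OF assms] by simp
qed

text \<open>
  Bounding the integral of the convex function \<open>1 / x\<close> over \<open>[n, n + 1]\<close> by the trapezoidal rule
  shows that the sequence decreases by at most \<open>1 / (4 * n * (n + 1))\<close> in each step. These decrements
  telescope, which bounds the sequence from below.
\<close>

lemma stirling_log_increasing:
  assumes "n > 0"
  shows "stirling_log n - 1 / (4 * real n) \<le> stirling_log (Suc n) - 1 / (4 * real (Suc n))"
proof -
  have "ln (real n + 1) - ln (real n) \<le> (1 / real n + 1 / (real n + 1)) / 2"
    using ln_inverse_approx_le[of "real n" 1] assms by (simp add: inverse_eq_divide)
  then have "(real n + 1 / 2) * (ln (real n + 1) - ln (real n)) - 1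
      \<le> (real n + 1 / 2) * ((1 / real n + 1 / (real n + 1)) / 2) - 1"
    by (intro diff_right_mono mult_left_mono) auto
  also have "\<dots> = 1 / (4 * real n) - 1 / (4 * real (Suc n))"
    using assms by (simp add: divide_simps) (simp add: algebra_simps)
  finally show ?thesis using stirling_log_diff[OF assms] by simp
qed

lemma stirling_log_lower:
  assumes "n > 0"
  shows "3 / 4 \<le> stirling_log n"
proof -
  \<comment> \<open>\<open>3 / 4\<close> is the value of the increasing sequence at \<open>n = 1\<close>.\<close>
  have "3 / 4 \<le> stirling_log n - 1 / (4 * real n)"
    using assms
  proof (induction n rule: nat_induct_non_zero)
    case 1
    show ?case by (simp add: stirling_log_def)
  next
    case (Suc n)
    then show ?case using stirling_log_increasing[of n] by simp
  qed
  moreover have "0 \<le> 1 / (4 * real n)" by simp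
  ultimately show ?thesis by linarith
qed

lemma wallis_product_eq:
  "(\<Prod>k=1..n. (4 * real k ^ 2) / (4 * real k ^ 2 - 1))
    = (4 ^ n * fact n ^ 2 / fact (2 * n)) ^ 2 / (2 * real n + 1)"
proof (induction n)
  case (Suc n)
  let ?w = "4 ^ n * fact n ^ 2 / fact (2 * n) :: real"
  let ?c = "2 * real n + 1" and ?P = "\<lambda>n. \<Prod>k=1..n. (4 * real k ^ 2) / (4 * real k ^ 2 - 1)"
  have factor: "4 * real (Suc n) ^ 2 - 1 = ?c * (2 * real (Suc n) + 1)"
    by (simp add: power2_eq_square algebra_simps)
  have "(fact (2 * Suc n) :: real) = 2 * real (Suc n) * ?c * fact (2 * n)"
    by (simp add: algebra_simps)
  then have w_Suc: "4 ^ Suc n * fact (Suc n) ^ 2 / fact (2 * Suc n) = ?w * (2 * real (Suc n) / ?c)"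
    unfolding fact_Suc[of n] by (simp add: power2_eq_square divide_simps) (simp add: algebra_simps)
  have "?P (Suc n) = ?P n * (4 * real (Suc n) ^ 2 / (4 * real (Suc n) ^ 2 - 1))"
    by simp
  also have "\<dots> = (?w ^ 2 / ?c) * (4 * real (Suc n) ^ 2 / (?c * (2 * real (Suc n) + 1)))"
    unfolding Suc.IH factor ..
  also have "\<dots> = (?w * (2 * real (Suc n) / ?c)) ^ 2 / (2 * real (Suc n) + 1)"
    by (simp add: power2_eq_square mult_ac del: of_nat_Suc)
  finally show ?case unfolding w_Suc .
qed simp

text \<open>
  In the combination \<open>2 * stirling_log n - stirling_log (2 * n)\<close>, whose limit is that of
  \<open>stirling_log\<close> itself, all powers of \<open>n\<close> and \<open>exp 1\<close> cancel except for a factor \<open>sqrt n\<close>, and what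
  is left is the central binomial coefficient. Wallis's product therefore determines the limit.
\<close>

lemma stirling_log_wallis:
  assumes "n > 0"
  shows "exp (2 * (2 * stirling_log n - stirling_log (2 * n)))
    = 2 * ((2 * real n + 1) / real n) * (\<Prod>k=1..n. (4 * real k ^ 2) / (4 * real k ^ 2 - 1))"
proof -
  let ?w = "4 ^ n * fact n ^ 2 / fact (2 * n) :: real"
  have "2 * (2 * stirling_log n - stirling_log (2 * n)) = ln (2 * ?w ^ 2 / real n)"
    using assms ln_realpow[of 2 2]
    by (simp add: stirling_log_def ln_mult ln_div ln_realpow algebra_simps)
  moreover have "2 * ?w ^ 2 / real n > 0" using assms by simp
  ultimately have "exp (2 * (2 * stirling_log n - stirling_log (2 * n))) = 2 * ?w ^ 2 / real n"
    by simp
  moreover have "2 * (c / r) * (v / c) = 2 * v / r" if "c \<noteq> 0" for c r v :: real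
    using that by simp
  moreover have "2 * real n + 1 \<noteq> 0" by linarith
  ultimately show ?thesis unfolding wallis_product_eq by metis
qed

lemma fact_ge_stirling:
  assumes "n > 0"
  shows "sqrt (2 * pi * real n) * (real n / exp 1) ^ n \<le> fact n"
proof -
  have dec: "decseq (\<lambda>n. stirling_log (Suc n))"
    by (intro decseq_SucI stirling_log_decreasing) simp
  obtain L where L: "(\<lambda>n. stirling_log (Suc n)) \<longlonglongrightarrow> L"
    using decseq_convergent[OF dec, of "3/4"] stirling_log_lower by (metis zero_less_Suc)
  then have lim: "stirling_log \<longlonglongrightarrow> L" by (simp add: filterlim_sequentially_Suc)
  have lim2: "(\<lambda>n. stirling_log (2 * n)) \<longlonglongrightarrow> L"
    by (rule filterlim_compose[OF lim]) (simp add: filterlim_subseq strict_mono_def)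
  have "(\<lambda>n. exp (2 * (2 * stirling_log n - stirling_log (2 * n)))) \<longlonglongrightarrow> exp (2 * (2 * L - L))"
    by (intro tendsto_intros lim lim2)
  moreover have "(\<lambda>n. exp (2 * (2 * stirling_log n - stirling_log (2 * n)))) \<longlonglongrightarrow> 2 * 2 * (pi / 2)"
  proof (rule Lim_transform_eventually)
    have "(\<lambda>n. 2 * (2 + inverse (real n)) *
        (\<Prod>k=1..n. (4 * real k ^ 2) / (4 * real k ^ 2 - 1))) \<longlonglongrightarrow> 2 * (2 + 0) * (pi / 2)"
      by (intro tendsto_intros wallis LIMSEQ_inverse_real_of_nat)
         (rule lim_inverse_n)
    then show "(\<lambda>n. 2 * (2 + inverse (real n)) *
        (\<Prod>k=1..n. (4 * real k ^ 2) / (4 * real k ^ 2 - 1))) \<longlonglongrightarrow> 2 * 2 * (pi / 2)" by simp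
    show "\<forall>\<^sub>F n in sequentially. 2 * (2 + inverse (real n)) *
        (\<Prod>k=1..n. (4 * real k ^ 2) / (4 * real k ^ 2 - 1))
        = exp (2 * (2 * stirling_log n - stirling_log (2 * n)))"
      using eventually_gt_at_top[of 0]
      by eventually_elim (subst stirling_log_wallis, auto simp: field_simps)
  qed
  ultimately have "exp (2 * L) = 2 * pi"
    using LIMSEQ_unique by fastforce
  then have "2 * L = ln (2 * pi)" by (metis ln_exp)
  then have L_eq: "L = ln (sqrt (2 * pi))" by (simp add: ln_sqrt)
  obtain k where k: "n = Suc k" using assms by (cases n) auto
  have "ln (sqrt (2 * pi)) \<le> stirling_log n"
    using decseq_ge[OF dec L, of k] by (simp add: k L_eq)
  moreover have "ln (sqrt (2 * pi * real n) * (real n / exp 1) ^ n)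
      = ln (sqrt (2 * pi)) + (real n + 1 / 2) * ln (real n) - real n"
    using assms by (simp add: ln_mult ln_div ln_realpow ln_sqrt real_sqrt_mult algebra_simps)
  ultimately have "ln (sqrt (2 * pi * real n) * (real n / exp 1) ^ n) \<le> ln (fact n)"
    by (simp add: stirling_log_def)
  then show ?thesis using assms by (subst (asm) ln_le_cancel_iff) auto
qed

section \<open>Lagrange weights on the triangular grid\<close>

definition grid :: "nat \<Rightarrow> (nat \<times> nat) set" where
  "grid m = {(i, j). i + j \<le> m}"

text \<open>
  For \<open>a + b + c = m\<close> this is the fundamental polynomial, in barycentric coordinates multiplied by
  \<open>m\<close>, that belongs to the node \<open>(i, j, m - i - j)\<close>. The three arguments are kept independent because
  the recursion below replaces \<open>m\<close> by \<open>m - 1\<close> and \<open>a\<close> by \<open>a - 1\<close>.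
\<close>

definition weight :: "nat \<Rightarrow> real \<Rightarrow> real \<Rightarrow> real \<Rightarrow> nat \<Rightarrow> nat \<Rightarrow> real" where
  "weight m a b c i j = (a gchoose i) * (b gchoose j) * (c gchoose (m - i - j))"

lemma grid_eq_Sigma: "grid m = Sigma {..m} (\<lambda>i. {..m - i})"
  by (auto simp: grid_def)

lemma sum_grid_nested: "(\<Sum>(i, j)\<in>grid m. h i j) = (\<Sum>i\<le>m. \<Sum>j\<le>m - i. h i j)"
  unfolding grid_eq_Sigma by (subst sum.Sigma) auto

lemma sum_grid_swap: "(\<Sum>(i, j)\<in>grid m. h i j) = (\<Sum>(i, j)\<in>grid m. h j i)"
  by (rule sum.reindex_bij_witness[of _ prod.swap prod.swap]) (auto simp: grid_def)

lemma weight_swap: "weight m a b c j i = weight m b a c i j"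
  by (simp add: weight_def algebra_simps diff_commute)

lemma sum_weight:
  assumes "a + b + c = real m"
  shows "(\<Sum>(i, j)\<in>grid m. weight m a b c i j) = 1"
proof -
  have "(\<Sum>(i, j)\<in>grid m. weight m a b c i j)
      = (\<Sum>i\<le>m. (a gchoose i) * (\<Sum>j\<le>m - i. (b gchoose j) * (c gchoose (m - i - j))))"
    by (simp add: sum_grid_nested weight_def sum_distrib_left mult.assoc)
  also have "\<dots> = (\<Sum>i\<le>m. (a gchoose i) * ((b + c) gchoose (m - i)))"
    by (simp only: gbinomial_Vandermonde[folded atMost_atLeast0])
  also have "\<dots> = (a + (b + c)) gchoose m"
    by (rule gbinomial_Vandermonde[folded atMost_atLeast0])
  also have "a + (b + c) = real m" using assms by simp
  also have "(real m gchoose m) = 1"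
    by (simp flip: binomial_gbinomial)
  finally show ?thesis .
qed

text \<open>
  The identity \<open>i * (a gchoose i) = a * ((a - 1) gchoose (i - 1))\<close> trades a factor \<open>i\<close> under the sum
  for a factor \<open>a\<close> in front of it, at the price of passing to the grid of the next smaller size. Both
  \<open>m\<close> and \<open>a\<close> drop by 1, so the relation \<open>a + b + c = m\<close> survives.
\<close>

lemma weight_absorb:
  "(\<Sum>(i, j)\<in>grid (Suc m). real i * (weight (Suc m) a b c i j * h i j))
     = a * (\<Sum>(i, j)\<in>grid m. weight m (a - 1) b c i j * h (Suc i) j)"
proof -
  have "(\<Sum>(i, j)\<in>grid (Suc m). real i * (weight (Suc m) a b c i j * h i j))
      = (\<Sum>(i, j)\<in>{(i, j)\<in>grid (Suc m). i > 0}. real i * (weight (Suc m) a b c i j * h i j))"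
    by (rule sum.mono_neutral_right) (auto simp: grid_eq_Sigma)
  also have "\<dots> = (\<Sum>(i, j)\<in>grid m. real (Suc i) * (weight (Suc m) a b c (Suc i) j * h (Suc i) j))"
    by (rule sum.reindex_bij_witness[of _ "\<lambda>(i, j). (Suc i, j)" "\<lambda>(i, j). (i - 1, j)"])
       (auto simp: grid_def)
  also have "\<dots> = (\<Sum>(i, j)\<in>grid m. a * (weight m (a - 1) b c i j * h (Suc i) j))"
  proof (intro sum.cong refl, clarify)
    fix i j :: nat
    have "real (Suc i) * (weight (Suc m) a b c (Suc i) j * h (Suc i) j)
        = (real (Suc i) * (a gchoose Suc i)) * ((b gchoose j) * (c gchoose (m - i - j)) * h (Suc i) j)"
      by (simp add: weight_def)
    also have "\<dots> = a * (weight m (a - 1) b c i j * h (Suc i) j)"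
      unfolding gbinomial_absorption by (simp add: weight_def)
    finally show "real (Suc i) * (weight (Suc m) a b c (Suc i) j * h (Suc i) j)
        = a * (weight m (a - 1) b c i j * h (Suc i) j)" .
  qed
  finally show ?thesis
    by (simp add: sum_distrib_left case_prod_unfold)
qed

text \<open>
  One induction serves both coordinates: it is used first with \<open>g = 1\<close> and then, after exchanging the
  coordinates, with \<open>g\<close> a power of \<open>j\<close>. The shift \<open>s\<close> makes the induction work, since
  the absorption step turns \<open>i + s\<close> into \<open>i + (s + 1)\<close> while it turns \<open>a\<close> into \<open>a - 1\<close>.
\<close>

lemma weight_raise_degree:
  assumes base: "\<And>m a c. a + b + c = real m \<Longrightarrow> q \<le> m \<Longrightarrow>
      (\<Sum>(i, j)\<in>grid m. weight m a b c i j * g j) = G"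
    and "a + b + c = real m" "p + q \<le> m"
  shows "(\<Sum>(i, j)\<in>grid m. weight m a b c i j * ((real i + s) ^ p * g j)) = (a + s) ^ p * G"
  using assms(2,3)
proof (induction p arbitrary: m a s)
  case 0
  then show ?case using base by simp
next
  case (Suc p)
  then obtain n where n: "m = Suc n" by (cases m) auto
  have split: "weight m a b c i j * ((real i + s) ^ Suc p * g j)
      = real i * (weight m a b c i j * ((real i + s) ^ p * g j))
        + s * (weight m a b c i j * ((real i + s) ^ p * g j))" for i j
    by (simp add: algebra_simps)
  have "(\<Sum>(i, j)\<in>grid m. weight m a b c i j * ((real i + s) ^ Suc p * g j))
      = (\<Sum>(i, j)\<in>grid m. real i * (weight m a b c i j * ((real i + s) ^ p * g j)))
        + s * (\<Sum>(i, j)\<in>grid m. weight m a b c i j * ((real i + s) ^ p * g j))"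
    unfolding split by (simp add: case_prod_unfold sum.distrib sum_distrib_left)
  also have "(\<Sum>(i, j)\<in>grid m. real i * (weight m a b c i j * ((real i + s) ^ p * g j)))
      = a * (\<Sum>(i, j)\<in>grid n. weight n (a - 1) b c i j * ((real i + (s + 1)) ^ p * g j))"
    unfolding n weight_absorb by (simp add: add_ac)
  also have "\<dots> = a * ((a - 1 + (s + 1)) ^ p * G)"
    using Suc.prems by (subst Suc.IH) (auto simp: n)
  also have "(\<Sum>(i, j)\<in>grid m. weight m a b c i j * ((real i + s) ^ p * g j)) = (a + s) ^ p * G"
    using Suc.prems by (intro Suc.IH) auto
  finally show ?case by (simp add: algebra_simps)
qed

lemma weight_moments:
  assumes "a + b + c = real m" "p + q \<le> m"
  shows "(\<Sum>(i, j)\<in>grid m. weight m a b c i j * (real i ^ p * real j ^ q)) = a ^ p * b ^ q"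
proof -
  have one: "(\<Sum>(i, j)\<in>grid m. weight m a b c i j * real i ^ p) = a ^ p"
    if "a + b + c = real m" "p \<le> m" for a b c m p
    using weight_raise_degree[of b 0 "\<lambda>_. 1" 1 a c m p 0] that by (simp add: sum_weight)
  have "(\<Sum>(i, j)\<in>grid m. weight m a b c i j * real j ^ q) = b ^ q"
    if "a + b + c = real m" "q \<le> m" for a c m
  proof -
    have "(\<Sum>(i, j)\<in>grid m. weight m a b c i j * real j ^ q)
        = (\<Sum>(i, j)\<in>grid m. weight m b a c i j * real i ^ q)"
      by (subst sum_grid_swap) (simp add: weight_swap)
    also have "\<dots> = b ^ q" using that by (intro one) auto
    finally show ?thesis .
  qed
  from weight_raise_degree[of b q "\<lambda>j. real j ^ q", OF this assms, of 0] show ?thesis by simp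
qed

text \<open>
  Each factor satisfies \<open>\<bar>a - i\<bar> \<le> a + i\<close>, and the products of the right-hand sides again satisfy a
  Vandermonde identity, so that they can be summed over the grid.
\<close>

lemma abs_gbinomial_le_pochhammer:
  fixes a :: real
  assumes "0 \<le> a"
  shows "\<bar>a gchoose n\<bar> \<le> pochhammer a n / fact n"
proof -
  have "\<bar>\<Prod>i = 0..<n. a - real i\<bar> \<le> (\<Prod>i = 0..<n. a + real i)"
    unfolding abs_prod using assms by (intro prod_mono) auto
  then show ?thesis
    by (simp add: gbinomial_prod_rev pochhammer_prod divide_right_mono)
qed

lemma pochhammer_Vandermonde:
  fixes a b :: real
  shows "(\<Sum>k\<le>n. pochhammer a k / fact k * (pochhammer b (n - k) / fact (n - k)))
    = pochhammer (a + b) n / fact n"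
  unfolding pochhammer_binomial_sum sum_divide_distrib
  by (intro sum.cong) (auto simp: binomial_fact field_simps)

lemma pochhammer_le_four_power: "pochhammer (real m) m / fact m \<le> 4 ^ m"
proof (cases "m = 0")
  case False
  have "pochhammer (real m) m / fact m = real (2 * m - 1) gchoose m"
    using False by (simp add: gbinomial_pochhammer' of_nat_diff)
  also have "\<dots> = real ((2 * m - 1) choose m)"
    by (simp add: binomial_gbinomial)
  also have "\<dots> \<le> 2 ^ (2 * m - 1)"
    by (metis binomial_le_pow2 of_nat_le_iff of_nat_numeral of_nat_power)
  also have "\<dots> \<le> (2::real) ^ (2 * m)"
    by (intro power_increasing) auto
  finally show ?thesis by (simp add: power_mult)
qed simp

text \<open>
  The Lebesgue constant of the nodes: after passing to rising factorials, two applications of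
  Vandermonde's identity leave \<open>pochhammer m m / fact m = (2 * m - 1) choose m\<close>.
\<close>

lemma sum_abs_weight_le:
  assumes "0 \<le> a" "0 \<le> b" "0 \<le> c" "a + b + c = real m"
  shows "(\<Sum>(i, j)\<in>grid m. \<bar>weight m a b c i j\<bar>) \<le> 4 ^ m"
proof -
  have "(\<Sum>(i, j)\<in>grid m. \<bar>weight m a b c i j\<bar>) \<le> (\<Sum>(i, j)\<in>grid m.
      pochhammer a i / fact i * (pochhammer b j / fact j * (pochhammer c (m - i - j) / fact (m - i - j))))"
  proof (intro sum_mono, clarify)
    fix i j :: nat
    have nonneg: "0 \<le> pochhammer d n / fact n" if "0 \<le> d" for d :: real and n
      using abs_gbinomial_le_pochhammer[OF that, of n] by linarith
    show "\<bar>weight m a b c i j\<bar> \<le> pochhammer a i / fact i *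
        (pochhammer b j / fact j * (pochhammer c (m - i - j) / fact (m - i - j)))"
      unfolding weight_def abs_mult mult.assoc
      by (intro mult_mono abs_gbinomial_le_pochhammer nonneg mult_nonneg_nonneg abs_ge_zero assms)
  qed
  also have "\<dots> = (\<Sum>i\<le>m. pochhammer a i / fact i * (pochhammer (b + c) (m - i) / fact (m - i)))"
    unfolding sum_grid_nested
    by (intro sum.cong refl) (simp only: flip: sum_distrib_left pochhammer_Vandermonde)
  also have "\<dots> = pochhammer (real m) m / fact m"
    unfolding pochhammer_Vandermonde using assms by (simp add: add.assoc)
  also have "\<dots> \<le> 4 ^ m" by (rule pochhammer_le_four_power)
  finally show ?thesis .
qed

lemma prod_shift_eq_gbinomial:
  assumes "m > 0"
  shows "(\<Prod>k<i. x + real k * (- 1 / real m)) = fact i * (real m * x gchoose i) / real m ^ i"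
proof -
  have "(\<Prod>k<i. x + real k * (- 1 / real m)) = (\<Prod>k<i. (real m * x - real k) / real m)"
    using assms by (intro prod.cong) (auto simp: field_simps)
  also have "\<dots> = fact i * (real m * x gchoose i) / real m ^ i"
    by (simp add: prod_dividef gbinomial_mult_fact lessThan_atLeast0)
  finally show ?thesis .
qed

lemma v_basis_eq_weight:
  assumes "m > 0" "i + j \<le> m"
  shows "fact m / (fact i * fact j * fact (m - i - j)) * v_basis m i j x y (- 1 / real m)
    = weight m (real m * x) (real m * y) (real m * (1 - x - y)) i j"
proof -
  have "real m ^ i * real m ^ j * real m ^ (m - i - j) = real m ^ m"
    using assms by (simp flip: power_add)
  moreover have "(\<Prod>k<m. 1 + real k * (- 1 / real m)) = fact m / real m ^ m"
    unfolding prod_shift_eq_gbinomial[OF assms(1), of 1] by (simp flip: binomial_gbinomial)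
  ultimately show ?thesis
    unfolding v_basis_def weight_def prod_shift_eq_gbinomial[OF assms(1)]
    using assms by (simp add: field_simps)
qed

section \<open>Taylor expansion on the triangle\<close>

text \<open>
  The integral form of the remainder is used because it is an integral in the sense of Henstock and
  Kurzweil: it yields the sharp constant \<open>1 / fact p\<close> although the derivative of order \<open>p\<close> is only
  known to be bounded, and although all derivatives are one-sided at the end points.
\<close>

lemma Taylor_remainder_le:
  fixes h :: "nat \<Rightarrow> real \<Rightarrow> real"
  assumes "0 < p" "0 \<le> u"
    and deriv: "\<And>i s. i < p \<Longrightarrow> 0 \<le> s \<Longrightarrow> s \<le> u \<Longrightarrow>
      (h i has_vector_derivative h (Suc i) s) (at s within {0..u})"
    and le: "\<And>s. 0 \<le> s \<Longrightarrow> s \<le> u \<Longrightarrow> \<bar>h p s\<bar> \<le> B"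
  shows "\<bar>h 0 u - (\<Sum>i<p. h i 0 * (u ^ i / fact i))\<bar> \<le> B * (u ^ p / fact p)"
proof -
  let ?K = "\<lambda>s. (u - s) ^ (p - 1) / fact (p - 1)"
  have 1: "((\<lambda>s. ?K s *\<^sub>R h p s) has_integral
      h 0 u - (\<Sum>i<p. ((u - 0) ^ i / fact i) *\<^sub>R h i 0)) {0..u}"
    by (rule Taylor_has_integral) (use assms in auto)
  have fact_p: "fact p = real p * fact (p - 1)"
    using \<open>0 < p\<close> by (simp add: fact_reduce)
  have "((\<lambda>s. B * ?K s) has_integral
      - (B * ((u - u) ^ p / fact p)) - - (B * ((u - 0) ^ p / fact p))) {0..u}"
    using \<open>0 \<le> u\<close> \<open>0 < p\<close>
    by (intro fundamental_theorem_of_calculus)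
       (auto intro!: derivative_eq_intros simp: fact_p field_simps
         simp flip: has_real_derivative_iff_has_vector_derivative)
  then have 2: "((\<lambda>s. B * ?K s) has_integral B * (u ^ p / fact p)) {0..u}"
    using \<open>0 < p\<close> by (simp add: zero_power)
  have "\<bar>?K s *\<^sub>R h p s\<bar> \<le> B * ?K s" if "s \<in> {0..u}" for s
  proof -
    have "0 \<le> ?K s" using that by simp
    moreover have "\<bar>h p s\<bar> \<le> B" using le that by simp
    ultimately show ?thesis
      unfolding real_scaleR_def abs_mult mult.commute[of B] by (simp only: abs_of_nonneg mult_left_mono)
  qed
  then have "\<bar>h 0 u - (\<Sum>i<p. ((u - 0) ^ i / fact i) *\<^sub>R h i 0)\<bar> \<le> B * (u ^ p / fact p)"
    using has_integral_norm_bound_integral_component[OF 1 2, of 1] by simp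
  then show ?thesis by (simp add: mult.commute)
qed

lemma mixed_partial_exists_mono_x:
  "mixed_partial_exists k l g \<Longrightarrow> k' \<le> k \<Longrightarrow> mixed_partial_exists k' l g"
  by (induction k) (auto simp: le_Suc_eq)

lemma mixed_partial_exists_mono_y:
  "mixed_partial_exists 0 l g \<Longrightarrow> l' \<le> l \<Longrightarrow> mixed_partial_exists 0 l' g"
  by (induction l) (auto simp: le_Suc_eq)

lemma mixed_partial_deriv_x:
  assumes "mixed_partial_exists (Suc k) l g" "(x, y) \<in> xy_dom (Suc k) l"
  shows "((\<lambda>u. mixed_partial k l g u y) has_vector_derivative mixed_partial (Suc k) l g x y)
    (at x within {0..1 - y})"
  using assms unfolding mixed_partial_exists.simps
  by (auto simp: mixed_partial_def partial_x_def vector_derivative_works)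

lemma mixed_partial_deriv_y:
  assumes "mixed_partial_exists 0 (Suc l) g" "(x, y) \<in> xy_dom 0 (Suc l)"
  shows "((\<lambda>v. mixed_partial 0 l g x v) has_vector_derivative mixed_partial 0 (Suc l) g x y)
    (at y within {0..1 - x})"
  using assms unfolding mixed_partial_exists.simps
  by (auto simp: mixed_partial_def partial_y_def vector_derivative_works)

text \<open>
  If \<open>y > 0\<close>, then \<open>x < 1\<close>, so the whole segment from \<open>(x, 0)\<close> to \<open>(x, y)\<close> avoids the corner
  \<open>(1, 0)\<close>, where derivatives in the second variable carry no information.
\<close>

lemma Taylor_y:
  assumes "0 < p" and ex: "mixed_partial_exists 0 p g"
    and le: "\<And>x y. (x, y) \<in> xy_dom 0 p \<Longrightarrow> \<bar>mixed_partial 0 p g x y\<bar> \<le> B"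
    and "0 \<le> x" "0 \<le> y" "x + y \<le> 1"
  shows "\<bar>g x y - (\<Sum>l<p. mixed_partial 0 l g x 0 * (y ^ l / fact l))\<bar> \<le> B * (y ^ p / fact p)"
proof (cases "y = 0")
  case True
  have "(\<Sum>l<p. mixed_partial 0 l g x 0 * (0 ^ l / fact l)) = mixed_partial 0 0 g x 0"
    using \<open>0 < p\<close> by (subst sum.remove[of _ 0]) auto
  then show ?thesis using True \<open>0 < p\<close> by (simp add: mixed_partial_def zero_power)
next
  case False
  have "\<bar>mixed_partial 0 0 g x y - (\<Sum>l<p. mixed_partial 0 l g x 0 * (y ^ l / fact l))\<bar>
      \<le> B * (y ^ p / fact p)"
  proof (rule Taylor_remainder_le)
    fix l s assume ls: "l < p" "0 \<le> s" "s \<le> y"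
    then have "(x, s) \<in> xy_dom 0 (Suc l)" using False assms(4-) by (auto simp: xy_dom_def)
    moreover have "mixed_partial_exists 0 (Suc l) g"
      using ex ls by (intro mixed_partial_exists_mono_y[OF ex]) auto
    ultimately show "(mixed_partial 0 l g x has_vector_derivative mixed_partial 0 (Suc l) g x s)
        (at s within {0..y})"
      using mixed_partial_deriv_y[of l g x s] assms(4-)
      by (auto intro: has_vector_derivative_within_subset[where S = "{0..1 - x}"])
  next
    fix s assume "0 \<le> s" "s \<le> y"
    then show "\<bar>mixed_partial 0 p g x s\<bar> \<le> B"
      using False assms(4-) by (intro le) (auto simp: xy_dom_def)
  qed (use assms in auto)
  then show ?thesis by (simp add: mixed_partial_def)
qed

lemma Taylor_x_axis:
  assumes "0 < p" and ex: "mixed_partial_exists p l g"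
    and le: "\<And>x y. (x, y) \<in> xy_dom p l \<Longrightarrow> \<bar>mixed_partial p l g x y\<bar> \<le> B"
    and "0 \<le> x" "x \<le> 1" "l = 0 \<or> x < 1"
  shows "\<bar>mixed_partial 0 l g x 0 - (\<Sum>k<p. mixed_partial k l g 0 0 * (x ^ k / fact k))\<bar>
      \<le> B * (x ^ p / fact p)"
proof (rule Taylor_remainder_le[where h = "\<lambda>k x. mixed_partial k l g x 0"])
  fix k s assume ks: "k < p" "0 \<le> s" "s \<le> x"
  then have "(s, 0) \<in> xy_dom (Suc k) l" using assms(4-) by (auto simp: xy_dom_def)
  moreover have "mixed_partial_exists (Suc k) l g"
    using ex ks by (intro mixed_partial_exists_mono_x[OF ex]) auto
  ultimately show "((\<lambda>x. mixed_partial k l g x 0) has_vector_derivative mixed_partial (Suc k) l g s 0)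
      (at s within {0..x})"
    using mixed_partial_deriv_x[of k l g s 0] assms(4-)
    by (auto intro: has_vector_derivative_within_subset[where S = "{0..1}"])
next
  fix s assume "0 \<le> s" "s \<le> x"
  then show "\<bar>mixed_partial p l g s 0\<bar> \<le> B"
    using assms(4-) by (intro le) (auto simp: xy_dom_def)
qed (use assms in auto)

text \<open>
  The expansion goes first from \<open>(x, 0)\<close> to \<open>(x, y)\<close> and then, for each coefficient, along the axis
  from the origin to \<open>(x, 0)\<close>. This order matches \<open>mixed_partial\<close>, where the differentiations in
  \<open>y\<close> come first, so that no derivatives have to be interchanged. The row with
  \<open>l\<close> derivatives in \<open>y\<close> is expanded up to the order \<open>p - l\<close>, so that all remainders contain
  derivatives of total order \<open>p\<close>, and the binomial theorem adds them up.
\<close>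

lemma Taylor_triangle:
  assumes "0 < p" and ex: "\<And>k. k \<le> p \<Longrightarrow> mixed_partial_exists k (p - k) g"
    and le: "\<And>k x y. k \<le> p \<Longrightarrow> (x, y) \<in> xy_dom k (p - k) \<Longrightarrow> \<bar>mixed_partial k (p - k) g x y\<bar> \<le> B"
    and xy: "0 \<le> x" "0 \<le> y" "x + y \<le> 1"
  shows "\<bar>g x y - (\<Sum>l<p. \<Sum>k<p - l. mixed_partial k l g 0 0 / (fact k * fact l) * (x ^ k * y ^ l))\<bar>
    \<le> B * ((x + y) ^ p / fact p)"
proof -
  let ?S = "\<lambda>l. \<Sum>k<p - l. mixed_partial k l g 0 0 * (x ^ k / fact k)"
  have row: "\<bar>(mixed_partial 0 l g x 0 - ?S l) * (y ^ l / fact l)\<bar>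
      \<le> B * (x ^ (p - l) / fact (p - l)) * (y ^ l / fact l)" if "l < p" for l
  proof (cases "l = 0 \<or> x < 1")
    case True
    have l: "p - (p - l) = l" using that by simp
    have "\<bar>mixed_partial 0 l g x 0 - ?S l\<bar> \<le> B * (x ^ (p - l) / fact (p - l))"
      using that xy True ex[of "p - l"] le[of "p - l"] unfolding l
      by (intro Taylor_x_axis) auto
    moreover have "0 \<le> y ^ l / fact l" using xy by simp
    ultimately show ?thesis by (simp only: abs_mult abs_of_nonneg mult_right_mono)
  next
    case False
    \<comment> \<open>The derivatives are meaningless at the corner \<open>(1, 0)\<close>, but the factor \<open>y ^ l\<close> vanishes there.\<close>
    then have "y = 0" "0 < l" using xy by auto
    then show ?thesis by (simp add: zero_power)
  qed
  have "\<bar>g x y - (\<Sum>l<p. ?S l * (y ^ l / fact l))\<bar>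
      = \<bar>(g x y - (\<Sum>l<p. mixed_partial 0 l g x 0 * (y ^ l / fact l)))
        + (\<Sum>l<p. (mixed_partial 0 l g x 0 - ?S l) * (y ^ l / fact l))\<bar>"
    unfolding left_diff_distrib sum_subtractf by simp
  also have "\<dots> \<le> B * (y ^ p / fact p)
      + (\<Sum>l<p. B * (x ^ (p - l) / fact (p - l)) * (y ^ l / fact l))"
    using Taylor_y[of p g B x y] ex[of 0] le[of 0] assms(1) xy
    by (intro order_trans[OF abs_triangle_ineq] add_mono order_trans[OF sum_abs] sum_mono row) auto
  also have "\<dots> = (\<Sum>l\<le>p. B * (x ^ (p - l) / fact (p - l)) * (y ^ l / fact l))"
    by (simp flip: lessThan_Suc_atMost)
  also have "\<dots> = B * ((x + y) ^ p / fact p)"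
    unfolding add.commute[of x] binomial_ring sum_divide_distrib sum_distrib_left
    by (intro sum.cong) (auto simp: binomial_fact field_simps)
  moreover have "(\<Sum>l<p. ?S l * (y ^ l / fact l))
      = (\<Sum>l<p. \<Sum>k<p - l. mixed_partial k l g 0 0 / (fact k * fact l) * (x ^ k * y ^ l))"
    unfolding sum_distrib_right by (intro sum.cong refl) simp
  ultimately show ?thesis by simp
qed

section \<open>The error of interpolation on the triangle\<close>

definition interp_weight :: "nat \<Rightarrow> real \<Rightarrow> real \<Rightarrow> nat \<Rightarrow> nat \<Rightarrow> real" where
  "interp_weight m x y i j =
    fact m / (fact i * fact j * fact (m - i - j)) * v_basis m i j x y (- 1 / real m)"

definition interp :: "nat \<Rightarrow> (real \<Rightarrow> real \<Rightarrow> real) \<Rightarrow> real \<Rightarrow> real \<Rightarrow> real" where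
  "interp m g x y = (\<Sum>(i, j)\<in>grid m. interp_weight m x y i j * g (real i / real m) (real j / real m))"

lemma interp_weight_eq:
  assumes "m > 0" "(i, j) \<in> grid m"
  shows "interp_weight m x y i j = weight m (real m * x) (real m * y) (real m * (1 - x - y)) i j"
  using v_basis_eq_weight assms unfolding interp_weight_def grid_def by blast

lemma interp_monomial:
  assumes "m > 0" "p + q \<le> m"
  shows "interp m (\<lambda>x y. x ^ p * y ^ q) x y = x ^ p * y ^ q"
proof -
  let ?W = "weight m (real m * x) (real m * y) (real m * (1 - x - y))"
  have "interp m (\<lambda>x y. x ^ p * y ^ q) x y
      = (\<Sum>(i, j)\<in>grid m. ?W i j * (real i ^ p * real j ^ q) / real m ^ (p + q))"
    unfolding interp_def
    by (intro sum.cong) (auto simp: interp_weight_eq[OF assms(1)] power_divide power_add)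
  also have "\<dots> = (\<Sum>(i, j)\<in>grid m. ?W i j * (real i ^ p * real j ^ q)) / real m ^ (p + q)"
    by (simp add: sum_divide_distrib case_prod_unfold)
  also have "(\<Sum>(i, j)\<in>grid m. ?W i j * (real i ^ p * real j ^ q)) = (real m * x) ^ p * (real m * y) ^ q"
    using assms(2) by (intro weight_moments) (auto simp: algebra_simps)
  finally show ?thesis using assms(1) by (simp add: power_mult_distrib power_add)
qed

lemma interp_sum:
  "interp m (\<lambda>x y. \<Sum>s\<in>S. c s * h s x y) x y = (\<Sum>s\<in>S. c s * interp m (h s) x y)"
proof -
  have "interp m (\<lambda>x y. \<Sum>s\<in>S. c s * h s x y) x y = (\<Sum>(i, j)\<in>grid m. \<Sum>s\<in>S.
      c s * (interp_weight m x y i j * h s (real i / real m) (real j / real m)))"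
    by (simp add: interp_def sum_distrib_left mult.left_commute)
  also have "\<dots> = (\<Sum>s\<in>S. c s * interp m (h s) x y)"
    unfolding interp_def case_prod_unfold sum_distrib_left by (rule sum.swap)
  finally show ?thesis .
qed

lemma interp_diff: "interp m (\<lambda>x y. g x y - h x y) x y = interp m g x y - interp m h x y"
  by (simp add: interp_def right_diff_distrib case_prod_unfold sum_subtractf)

lemma abs_interp_le:
  assumes "m > 0" "0 \<le> x" "0 \<le> y" "x + y \<le> 1"
    and le: "\<And>x y. 0 \<le> x \<Longrightarrow> 0 \<le> y \<Longrightarrow> x + y \<le> 1 \<Longrightarrow> \<bar>h x y\<bar> \<le> C"
  shows "\<bar>interp m h x y\<bar> \<le> 4 ^ m * C"
proof -
  let ?W = "weight m (real m * x) (real m * y) (real m * (1 - x - y))"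
  have "\<bar>interp m h x y\<bar> \<le> (\<Sum>(i, j)\<in>grid m. \<bar>?W i j\<bar> * C)"
    unfolding interp_def
  proof (rule order_trans[OF sum_abs], intro sum_mono, clarify)
    fix i j assume ij: "(i, j) \<in> grid m"
    then have "real i / real m + real j / real m \<le> 1"
      using assms(1) by (simp add: grid_def field_simps flip: of_nat_add)
    then show "\<bar>interp_weight m x y i j * h (real i / real m) (real j / real m)\<bar> \<le> \<bar>?W i j\<bar> * C"
      unfolding interp_weight_eq[OF assms(1) ij] abs_mult
      by (intro mult_left_mono le) auto
  qed
  also have "\<dots> = (\<Sum>(i, j)\<in>grid m. \<bar>?W i j\<bar>) * C"
    by (simp add: sum_distrib_right case_prod_unfold)
  also have "\<dots> \<le> 4 ^ m * C"
  proof (intro mult_right_mono sum_abs_weight_le)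
    show "0 \<le> C" using le[of 0 0] by simp
    show "real m * x + real m * y + real m * (1 - x - y) = real m" by (simp add: algebra_simps)
  qed (use assms(2-4) in auto)
  finally show ?thesis .
qed

text \<open>
  Both terms of \<open>(g - T) - interp m (g - T)\<close> are controlled by the Taylor remainder, which is bounded
  on the whole triangle and in particular at the nodes.
\<close>

lemma interp_error_le:
  assumes "m > 0" and ex: "\<And>k. k \<le> Suc m \<Longrightarrow> mixed_partial_exists k (Suc m - k) g"
    and le: "\<And>k x y. k \<le> Suc m \<Longrightarrow> (x, y) \<in> xy_dom k (Suc m - k) \<Longrightarrow>
      \<bar>mixed_partial k (Suc m - k) g x y\<bar> \<le> B"
    and xy: "0 \<le> x" "0 \<le> y" "x + y \<le> 1"
  shows "\<bar>g x y - interp m g x y\<bar> \<le> (1 + 4 ^ m) * (B / fact (Suc m))"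
proof -
  define T where "T x y = (\<Sum>(l, k)\<in>grid m. mixed_partial k l g 0 0 / (fact k * fact l) * (x ^ k * y ^ l))"
    for x y
  have T_eq: "T x y = (\<Sum>l<Suc m. \<Sum>k<Suc m - l.
      mixed_partial k l g 0 0 / (fact k * fact l) * (x ^ k * y ^ l))" for x y
    unfolding T_def sum_grid_nested by (intro sum.cong) auto
  have "0 \<le> B"
    using order_trans[OF abs_ge_zero le[of 0 0 0]] by (simp add: xy_dom_def)
  have rem: "\<bar>g x y - T x y\<bar> \<le> B / fact (Suc m)" if "0 \<le> x" "0 \<le> y" "x + y \<le> 1" for x y
  proof -
    have "\<bar>g x y - T x y\<bar> \<le> B * ((x + y) ^ Suc m / fact (Suc m))"
      unfolding T_eq by (rule Taylor_triangle) (use ex le that in auto)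
    also have "\<dots> \<le> B * (1 / fact (Suc m))"
      using that \<open>0 \<le> B\<close> by (intro mult_left_mono divide_right_mono power_le_one) auto
    finally show ?thesis by simp
  qed
  have "interp m T x y = T x y"
    unfolding T_def[abs_def] case_prod_unfold interp_sum
    by (intro sum.cong refl arg_cong2[where f = "(*)"] interp_monomial assms(1))
       (auto simp: grid_def)
  then have "g x y - interp m g x y = (g x y - T x y) - interp m (\<lambda>x y. g x y - T x y) x y"
    by (simp add: interp_diff)
  also have "\<bar>\<dots>\<bar> \<le> B / fact (Suc m) + 4 ^ m * (B / fact (Suc m))"
    using rem[OF xy] abs_interp_le[OF assms(1) xy, of "\<lambda>x y. g x y - T x y", OF rem] by linarith
  finally show ?thesis by (simp only: distrib_right mult_1)
qed

section \<open>Integration over the triangle and the error of the operator polynomial\<close>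

lemma compact_Delta2: "compact Delta2"
proof -
  have "Delta2 = cbox (0, 0) (1, 1) \<inter> {z. fst z + snd z \<le> 1}"
    by (auto simp: Delta2_def cbox_Pair_eq)
  moreover have "closed {z :: real \<times> real. fst z + snd z \<le> 1}"
    by (intro closed_Collect_le continuous_intros)
  ultimately show ?thesis by (metis compact_Int_closed compact_cbox)
qed

lemma measure_Delta2_le: "measure lborel Delta2 \<le> 1"
proof -
  have "measure lborel Delta2 \<le> measure lborel (cbox (0, 0) (1, 1) :: (real \<times> real) set)"
  proof (rule measure_mono_fmeasurable[OF _ _ fmeasurable_cbox])
    show "Delta2 \<subseteq> cbox (0, 0) (1, 1)" by (auto simp: Delta2_def cbox_Pair_eq)
    show "Delta2 \<in> sets lborel" using compact_Delta2 by (simp add: borel_compact)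
  qed
  also have "\<dots> = 1"
    by (simp add: content_Pair)
  finally show ?thesis .
qed

lemma abs_set_integral_Delta2_le:
  fixes h :: "real \<times> real \<Rightarrow> real"
  assumes "continuous_on Delta2 h" and le: "\<And>z. z \<in> Delta2 \<Longrightarrow> \<bar>h z\<bar> \<le> C"
  shows "\<bar>set_lebesgue_integral lborel Delta2 h\<bar> \<le> C"
proof -
  have fin: "emeasure lborel Delta2 < \<infinity>"
    by (rule emeasure_compact_finite[OF compact_Delta2])
  have sets: "Delta2 \<in> sets lborel" using compact_Delta2 by (simp add: borel_compact)
  have "\<bar>h (0, 0)\<bar> \<le> C" by (rule le) (simp add: Delta2_def)
  then have "0 \<le> C" by linarith
  have "set_integrable lborel Delta2 h"
    unfolding set_integrable_def by (rule borel_integrable_compact[OF compact_Delta2 assms(1)])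
  then have "\<bar>set_lebesgue_integral lborel Delta2 h\<bar> \<le> set_lebesgue_integral lborel Delta2 (\<lambda>z. \<bar>h z\<bar>)"
    using set_integral_norm_bound by fastforce
  also have "\<dots> \<le> set_lebesgue_integral lborel Delta2 (\<lambda>z. C)"
    using \<open>set_integrable lborel Delta2 h\<close> le sets fin
    by (intro set_integral_mono set_integrable_abs) (auto simp: set_integrable_def)
  also have "\<dots> = measure lborel Delta2 * C"
    using sets fin by (simp add: set_lebesgue_integral_def)
  also have "\<dots> \<le> C"
    using measure_Delta2_le \<open>0 \<le> C\<close> by (simp add: mult_left_le_one_le)
  finally show ?thesis .
qed

lemma partial_le_D_max:
  assumes "D_max_exists N f" "k \<le> N" "t \<in> {0..1}" "(z1, z2) \<in> Delta2" "(x, y) \<in> xy_dom k (N - k)"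
  shows "\<bar>mixed_partial k (N - k) (f t z1 z2) x y\<bar> \<le> D_max N f"
  unfolding D_max_def
proof (rule cSup_upper)
  show "\<bar>mixed_partial k (N - k) (f t z1 z2) x y\<bar> \<in> abs_partials N f"
    unfolding abs_partials_def using assms(2-) by blast
  show "bdd_above (abs_partials N f)"
    using assms(1) by (simp add: D_max_exists_def)
qed

lemma D_max_nonneg:
  assumes "D_max_exists N f"
  shows "0 \<le> D_max N f"
proof -
  have "\<bar>mixed_partial 0 (N - 0) (f 0 0 0) 0 0\<bar> \<le> D_max N f"
    by (rule partial_le_D_max[OF assms]) (simp_all add: Delta2_def xy_dom_def)
  then show ?thesis by linarith
qed

lemma continuous_on_Urison_integrand:
  assumes "continuous_on ({0..1} \<times> {0..1} \<times> {0..1} \<times> {0..1} \<times> {0..1})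
                   (\<lambda>(t, z1, z2, x, y). f t z1 z2 x y)"
    and "t \<in> {0..1}" "continuous_on Delta2 u" "continuous_on Delta2 w"
    and "\<And>z. z \<in> Delta2 \<Longrightarrow> u z \<in> {0..1} \<and> w z \<in> {0..1}"
  shows "continuous_on Delta2 (\<lambda>z. f t (fst z) (snd z) (u z) (w z) :: real)"
proof -
  have "continuous_on Delta2 ((\<lambda>(t, z1, z2, x, y). f t z1 z2 x y)
      \<circ> (\<lambda>z. (t, fst z, snd z, u z, w z)))"
    using assms(2-)
    by (intro continuous_on_compose continuous_intros continuous_on_subset[OF assms(1)])
       (auto simp: Delta2_def)
  then show ?thesis by (simp add: o_def)
qed

lemma R_op_eq_set_integral:
  assumes cont: "continuous_on ({0..1} \<times> {0..1} \<times> {0..1} \<times> {0..1} \<times> {0..1})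
                   (\<lambda>(t, z1, z2, x, y). f t z1 z2 x y)"
    and t: "t \<in> {0..1}" and Phi: "(x, y) \<in> Phi" and m: "m > 0"
  defines "h \<equiv> \<lambda>z. f t (fst z) (snd z) (x (fst z)) (y (snd z))
      - interp m (f t (fst z) (snd z)) (x (fst z)) (y (snd z))"
  shows "continuous_on Delta2 h"
    and "R_op m (- 1 / real m) f t x y = set_lebesgue_integral lborel Delta2 h"
proof -
  have x_cont: "continuous_on Delta2 (\<lambda>z. x (fst z))" and y_cont: "continuous_on Delta2 (\<lambda>z. y (snd z))"
    using Phi
    by (auto simp: Phi_def Delta2_def intro!: continuous_on_compose2[of "{0..1}" x]
        continuous_on_compose2[of "{0..1}" y] continuous_intros)
  have F: "continuous_on Delta2 (\<lambda>z. f t (fst z) (snd z) (x (fst z)) (y (snd z)))"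
    by (rule continuous_on_Urison_integrand[OF cont t x_cont y_cont])
       (use Phi in \<open>fastforce simp: Phi_def\<close>)
  have "continuous_on Delta2 (\<lambda>z. \<Sum>q\<in>grid m. interp_weight m (x (fst z)) (y (snd z)) (fst q) (snd q)
      * f t (fst z) (snd z) (real (fst q) / real m) (real (snd q) / real m))"
    unfolding interp_weight_def v_basis_def
    by (intro continuous_intros continuous_on_Urison_integrand[OF cont t] x_cont y_cont)
       (use m in \<open>auto simp: grid_def\<close>)
  then have P: "continuous_on Delta2 (\<lambda>z. interp m (f t (fst z) (snd z)) (x (fst z)) (y (snd z)))"
    by (simp add: interp_def case_prod_unfold)
  show "continuous_on Delta2 h"
    unfolding h_def by (intro continuous_intros F P)
  have integrable: "set_integrable lborel Delta2 g" if "continuous_on Delta2 g" for g :: "_ \<Rightarrow> real"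
    unfolding set_integrable_def by (rule borel_integrable_compact[OF compact_Delta2 that])
  show "R_op m (- 1 / real m) f t x y = set_lebesgue_integral lborel Delta2 h"
    unfolding h_def set_integral_diff(2)[OF integrable[OF F] integrable[OF P]]
    by (simp add: R_op_def Urison_def P_op_def interp_def interp_weight_def grid_def case_prod_unfold)
qed

theorem theorem8:
  fixes f :: "real \<Rightarrow> real \<Rightarrow> real \<Rightarrow> real \<Rightarrow> real \<Rightarrow> real" and M :: real
  assumes cont: "continuous_on ({0..1} \<times> {0..1} \<times> {0..1} \<times> {0..1} \<times> {0..1})
                   (\<lambda>(t, z1, z2, x, y). f t z1 z2 x y)"
    and D_ex: "\<And>n::nat. n \<ge> 1 \<Longrightarrow> D_max_exists (n + 1) f"
    and conv: "\<And>m::nat. m \<ge> 1 \<Longrightarrow>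
       summable (\<lambda>i. 2 ^ i * D_max (m + 1 + i) f / (\<Prod>j=1..i + 1. real (m + j)))"
    and bound: "\<And>m::nat. m \<ge> 1 \<Longrightarrow>
       (\<Sum>i. 2 ^ i * D_max (m + 1 + i) f / (\<Prod>j=1..i + 1. real (m + j))) \<le> M"
  shows "\<forall>m::nat. \<forall>t\<in>{0..1}. \<forall>(x, y)\<in>Phi. m \<ge> 1 \<longrightarrow>
     \<bar>R_op m (- 1 / real m) f t x y\<bar> \<le> 2 ^ (2 * m + 1) / fact m * M \<and>
     2 ^ (2 * m + 1) / fact m * M
       \<le> sqrt 2 / sqrt (pi * real m) * (4 * exp 1 / real m) ^ m * M"
proof (clarify, intro conjI)
  fix m :: nat and t :: real and x y :: "real \<Rightarrow> real"
  assume t: "t \<in> {0..1}" and Phi: "(x, y) \<in> Phi" and m: "1 \<le> m"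
  let ?D = "D_max (Suc m) f"
  have m_pos: "m > 0" using m by simp
  have D: "D_max_exists (Suc m) f" using D_ex[OF m] by simp
  have D_nonneg: "0 \<le> D_max (m + 1 + i) f" for i
    using D_ex[of "m + i"] m by (intro D_max_nonneg) (simp add: add_ac)
  \<comment> \<open>Only the first term of the series enters; the others are nonnegative.\<close>
  have "?D / real (Suc m)
      \<le> (\<Sum>i. 2 ^ i * D_max (m + 1 + i) f / (\<Prod>j=1..i + 1. real (m + j)))"
    using sum_le_suminf[OF conv[OF m], of "{0}"] D_nonneg
    by (simp add: prod_nonneg zero_le_divide_iff)
  with bound[OF m] have first_term: "?D / real (Suc m) \<le> M" by linarith
  have "0 \<le> ?D / real (Suc m)" using D_nonneg[of 0] by simp
  with first_term have "0 \<le> M" by linarith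

  have point: "\<bar>f t (fst z) (snd z) (x (fst z)) (y (snd z))
      - interp m (f t (fst z) (snd z)) (x (fst z)) (y (snd z))\<bar> \<le> (1 + 4 ^ m) * (?D / fact (Suc m))"
    if "z \<in> Delta2" for z
  proof (rule interp_error_le)
    have z: "(fst z, snd z) \<in> Delta2" using that by simp
    show "mixed_partial_exists k (Suc m - k) (f t (fst z) (snd z))" if "k \<le> Suc m" for k
      using D[unfolded D_max_exists_def, THEN conjunct1, rule_format, OF t z] that
      by (simp add: case_prod_unfold)
    show "\<bar>mixed_partial k (Suc m - k) (f t (fst z) (snd z)) x y\<bar> \<le> ?D"
      if "k \<le> Suc m" "(x, y) \<in> xy_dom k (Suc m - k)" for k x y
      using D that(1) t z that(2) by (rule partial_le_D_max)
  qed (use m that Phi in \<open>auto simp: Phi_def\<close>)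
  have "\<bar>R_op m (- 1 / real m) f t x y\<bar> \<le> (1 + 4 ^ m) * (?D / fact (Suc m))"
    unfolding R_op_eq_set_integral(2)[OF cont t Phi m_pos]
    by (rule abs_set_integral_Delta2_le[OF R_op_eq_set_integral(1)[OF cont t Phi m_pos] point])
  also have "\<dots> = (1 + 4 ^ m) / fact m * (?D / real (Suc m))"
    by (simp add: field_simps)
  also have "\<dots> \<le> (1 + 4 ^ m) / fact m * M"
    by (intro mult_left_mono first_term) auto
  also have "\<dots> \<le> 2 ^ (2 * m + 1) / fact m * M"
    using \<open>0 \<le> M\<close> by (intro mult_right_mono divide_right_mono) (auto simp: power_mult)
  finally show "\<bar>R_op m (- 1 / real m) f t x y\<bar> \<le> 2 ^ (2 * m + 1) / fact m * M" .

  let ?s = "sqrt (2 * pi * real m) * (real m / exp 1) ^ m"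
  have "?s > 0" using m by simp
  have "2 ^ (2 * m + 1) / fact m \<le> 2 ^ (2 * m + 1) / ?s"
    using fact_ge_stirling[of m] \<open>?s > 0\<close> m by (intro divide_left_mono) auto
  also have "\<dots> = (2 / sqrt 2) / sqrt (pi * real m) * (4 * exp 1 / real m) ^ m"
  proof -
    have "(2::real) ^ (2 * m + 1) = 2 * 4 ^ m" by (simp add: power_mult)
    then show ?thesis
      using m by (simp add: real_sqrt_mult power_divide power_mult_distrib field_simps)
  qed
  also have "2 / sqrt 2 = sqrt 2" by (simp add: real_div_sqrt)
  finally show "2 ^ (2 * m + 1) / fact m * M
       \<le> sqrt 2 / sqrt (pi * real m) * (4 * exp 1 / real m) ^ m * M"
    using \<open>0 \<le> M\<close> by (rule mult_right_mono)
qed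

end
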